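(* Let $\mathcal{X}$ be an ellipse in the Euclidean plane and let $\mathcal{R}$ be a conic confocal to $\mathcal{X}$. Let $P$ and $Q$ be two distinct points on the conic $\mathcal{R}$ and let $t_P$ and $t_Q$ be the two tangents to $\mathcal{R}$ through $P$ and $Q$, respectively. Then the two tangents $t_P$ and $t_Q$ intersect in a point $M$. The point $M$ is the center of a circle $\mathcal{C}$ touching the four tangents $a,b,c,d$ from $P$ and $Q$ to $\mathcal{X}$ (where $a,b$ are the tangents from $P$ and $c,d$ are the tangents from $Q$). Conversely, consider four tangents $a,b,c,d$ that are simultaneously tangent to $\mathcal{X}$ and to a circle $\mathcal{C}$. Let $M$ be the center of the circle and let $P=a\wedge b$ and $Q=c\wedge d$. Then there is a conic $\mathcal{R}$ confocal to $\mathcal{X}$ and tangent to the lines $M\vee P$ and $M\vee Q$ at $P$ and $Q$, respectively.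
   Context: For two lines $a,b$, the symbol $a\wedge b$ denotes their point of intersection; for two points $M,P$, the symbol $M\vee P$ denotes the line joining them. Two conics are confocal if they have the same foci. Projectively: over the complex projective plane with absolute circle points $\mathsf{I}=(1,i,0)$, $\mathsf{J}=(1,-i,0)$, the foci of a conic (neither degenerate nor a circle) are the four intersections, other than $\mathsf{I},\mathsf{J}$ themselves, of the four tangents from $\mathsf{I}$ and $\mathsf{J}$ to the conic, and two conics share the same foci if these tangents are identical. The conic $\mathcal{R}$ may be an ellipse or a hyperbola. Conventions for limit situations: if $P$ lies on both $\mathcal{R}$ and $\mathcal{X}$, the tangents $a$ and $b$ coincide, and touching both of them is understood as the limit condition that the circle is tangent to the line $a=b$ and contains the point $P$ (similarly for $Q$); if $P$ or $Q$ lies inside $\mathcal{X}$, the corresponding tangents are complex, and touching is understood as a purely algebraic condition.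
   Formalization: R is assumed different from X; the circle claim is made only when the tangents at P and Q are not parallel (M finite); in the converse M must not lie on the line PQ, and the circle C must differ from X. In the excluded cases the claim fails or is undefined. *)

theory Defs
  imports "HOL-Analysis.Analysis"
begin

text \<open>
  Points and lines of the complex projective plane are nonzero vectors in \<open>complex^3\<close>, taken up to
  a nonzero scalar. All pairings below are bilinear (no complex conjugation).
\<close>

definition proj_eq :: "complex^3 \<Rightarrow> complex^3 \<Rightarrow> bool" where
  "proj_eq u v \<longleftrightarrow> u \<noteq> 0 \<and> v \<noteq> 0 \<and> (\<exists>k. u = k *s v)"

definition incident :: "complex^3 \<Rightarrow> complex^3 \<Rightarrow> bool" where
  "incident p l \<longleftrightarrow> scalar_product p l = 0"

text \<open>
  The cross product gives both the line joining two points and the intersection of two lines; it is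
  zero exactly when the two arguments are linearly dependent.
\<close>

definition cross :: "complex^3 \<Rightarrow> complex^3 \<Rightarrow> complex^3" where
  "cross u v = vector [u$2 * v$3 - u$3 * v$2, u$3 * v$1 - u$1 * v$3, u$1 * v$2 - u$2 * v$1]"

abbreviation join :: "complex^3 \<Rightarrow> complex^3 \<Rightarrow> complex^3" where
  "join \<equiv> cross"

abbreviation meet :: "complex^3 \<Rightarrow> complex^3 \<Rightarrow> complex^3" where
  "meet \<equiv> cross"

definition hpt :: "real^2 \<Rightarrow> complex^3" where
  "hpt p = vector [complex_of_real (p$1), complex_of_real (p$2), 1]"

definition cvec :: "real^3 \<Rightarrow> complex^3" where
  "cvec v = (\<chi> i. complex_of_real (v$i))"

definition cmat :: "real^3^3 \<Rightarrow> complex^3^3" where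
  "cmat = map_matrix complex_of_real"

definition real_point :: "complex^3 \<Rightarrow> bool" where
  "real_point p \<longleftrightarrow> (\<exists>v. proj_eq p (cvec v))"

text \<open>A nondegenerate conic is given by an invertible symmetric matrix, up to a nonzero scalar.\<close>

definition nondeg_conic :: "complex^3^3 \<Rightarrow> bool" where
  "nondeg_conic A \<longleftrightarrow> transpose A = A \<and> invertible A"

definition same_conic :: "complex^3^3 \<Rightarrow> complex^3^3 \<Rightarrow> bool" where
  "same_conic A B \<longleftrightarrow> (\<exists>k. k \<noteq> 0 \<and> (\<forall>i j. A$i$j = k * B$i$j))"

definition on_conic :: "complex^3^3 \<Rightarrow> complex^3 \<Rightarrow> bool" where
  "on_conic A p \<longleftrightarrow> p \<noteq> 0 \<and> scalar_product p (A *v p) = 0"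

text \<open>The line \<open>l\<close> touches the conic \<open>A\<close> at the point \<open>p\<close>, which may be complex or at infinity.\<close>

definition tangent_at :: "complex^3^3 \<Rightarrow> complex^3 \<Rightarrow> complex^3 \<Rightarrow> bool" where
  "tangent_at A p l \<longleftrightarrow> on_conic A p \<and> proj_eq l (A *v p)"

definition tangent :: "complex^3^3 \<Rightarrow> complex^3 \<Rightarrow> bool" where
  "tangent A l \<longleftrightarrow> (\<exists>p. tangent_at A p l)"

definition circ_I :: "complex^3" where "circ_I = vector [1, \<i>, 0]"

definition circ_J :: "complex^3" where "circ_J = vector [1, - \<i>, 0]"

text \<open>
  The foci of a conic are the intersections, other than the circle points, of its tangents through
  the two circle points. Two conics have the same foci when these isotropic tangents coincide.
\<close>

definition isotropic_tangents :: "complex^3^3 \<Rightarrow> (complex^3) set" where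
  "isotropic_tangents A = {l. tangent A l \<and> (incident circ_I l \<or> incident circ_J l)}"

definition confocal :: "complex^3^3 \<Rightarrow> complex^3^3 \<Rightarrow> bool" where
  "confocal A B \<longleftrightarrow> isotropic_tangents A = isotropic_tangents B"

text \<open>
  An ellipse is a nondegenerate real conic with a real point in the affine plane and without real
  points at infinity. The first condition excludes conics without real points such as
  \<open>x\<^sup>2 + y\<^sup>2 + 1 = 0\<close>.
\<close>

definition ellipse :: "real^3^3 \<Rightarrow> bool" where
  "ellipse X \<longleftrightarrow> nondeg_conic (cmat X) \<and> (\<exists>p. on_conic (cmat X) (hpt p)) \<and>
     (\<forall>v. v$3 = 0 \<longrightarrow> \<not> on_conic (cmat X) (cvec v))"

text \<open>
  \<open>circle m \<rho>\<close> is the matrix of \<open>(x - m\<^sub>1)\<^sup>2 + (y - m\<^sub>2)\<^sup>2 = \<rho>\<close>. Thus \<open>\<rho>\<close> is the square of the radius; a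
  negative value gives an algebraic circle with real center and purely imaginary radius.
\<close>

definition circle :: "real^2 \<Rightarrow> real \<Rightarrow> real^3^3" where
  "circle m \<rho> = vector [vector [1, 0, - (m$1)],
                        vector [0, 1, - (m$2)],
                        vector [- (m$1), - (m$2), (m$1)\<^sup>2 + (m$2)\<^sup>2 - \<rho>]]"

lemma on_circle_iff:
  assumes "r \<ge> 0"
  shows "on_conic (cmat (circle m (r\<^sup>2))) (hpt p) \<longleftrightarrow> dist m p = r"
proof -
  have nz: "hpt p \<noteq> 0"
    by (simp add: hpt_def vec_eq_iff forall_3)
  have "scalar_product (hpt p) (cmat (circle m (r\<^sup>2)) *v hpt p) =
      complex_of_real ((p$1 - m$1)\<^sup>2 + (p$2 - m$2)\<^sup>2 - r\<^sup>2)"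
    by (simp add: scalar_product_def hpt_def cmat_def circle_def matrix_vector_mult_def sum_3
        power2_eq_square algebra_simps)
  moreover have "(dist m p)\<^sup>2 = (p$1 - m$1)\<^sup>2 + (p$2 - m$2)\<^sup>2"
    by (simp only: dist_norm power2_norm_eq_inner)
      (simp add: inner_vec_def sum_2 power2_eq_square algebra_simps)
  ultimately have "on_conic (cmat (circle m (r\<^sup>2))) (hpt p) \<longleftrightarrow> (dist m p)\<^sup>2 = r\<^sup>2"
    unfolding on_conic_def using nz by (simp only: of_real_eq_0_iff) auto
  then show ?thesis
    using assms by simp
qed

text \<open>
  \<open>a\<close> and \<open>b\<close> are all the tangents from \<open>p\<close> to \<open>A\<close>; they coincide if and only if \<open>p\<close> is on \<open>A\<close>.
\<close>

definition tangents_from :: "complex^3^3 \<Rightarrow> complex^3 \<Rightarrow> complex^3 \<Rightarrow> complex^3 \<Rightarrow> bool" where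
  "tangents_from A p a b \<longleftrightarrow> a \<noteq> 0 \<and> b \<noteq> 0 \<and>
     (\<forall>l. tangent A l \<and> incident p l \<longleftrightarrow> proj_eq l a \<or> proj_eq l b)"

text \<open>The last conjunct is the limit condition for two coinciding tangents from \<open>p\<close>.\<close>

definition touches_both :: "complex^3^3 \<Rightarrow> complex^3 \<Rightarrow> complex^3 \<Rightarrow> complex^3 \<Rightarrow> bool" where
  "touches_both C p a b \<longleftrightarrow> tangent C a \<and> tangent C b \<and> (proj_eq a b \<longrightarrow> on_conic C p)"

text \<open>
  The intersection of two common tangents \<open>a\<close> and \<open>b\<close> of \<open>A\<close> and \<open>C\<close>. If \<open>a\<close> and \<open>b\<close> coincide,
  it is in the limit a point where both conics touch this line.
\<close>

definition tangents_meet ::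
    "complex^3^3 \<Rightarrow> complex^3^3 \<Rightarrow> complex^3 \<Rightarrow> complex^3 \<Rightarrow> complex^3 \<Rightarrow> bool" where
  "tangents_meet A C a b p \<longleftrightarrow>
     (if proj_eq a b then tangent_at A p a \<and> tangent_at C p a else proj_eq p (meet a b))"

text \<open>A real point lies inside a real conic if no real tangent of the conic passes through it.\<close>

definition lies_inside :: "real^3^3 \<Rightarrow> real^2 \<Rightarrow> bool" where
  "lies_inside X z \<longleftrightarrow> \<not> (\<exists>l. tangent (cmat X) (cvec l) \<and> incident (hpt z) (cvec l))"

end

theory Submission
  imports Defs
begin

text \<open>
  In terms of the dual conics (adjugates) \<open>X\<^sup>*\<close>, \<open>R\<^sup>*\<close>, and with \<open>E = diag(1, 1, 0)\<close> the dual absolute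
  conic, confocality says \<open>R\<^sup>* = k X\<^sup>* + \<mu> E\<close>, and a circle with center \<open>M\<close> and squared radius \<open>\<rho>\<close>
  has the dual \<open>M M\<^sup>T - \<rho> E\<close>.

  On the pencil of lines through a point \<open>P\<close> of \<open>R\<close>, the form \<open>R\<^sup>*\<close> has the tangent at \<open>P\<close> as a double
  zero, so it is a multiple of \<open>(M l)\<^sup>2\<close> there; the factors for \<open>P\<close> and \<open>Q\<close> agree on the line \<open>P Q\<close>.
  Hence \<open>k X\<^sup>*\<close> is on both pencils a multiple of the dual of one circle with center \<open>M\<close>.

  Conversely, \<open>X\<^sup>*\<close> and the dual \<open>C\<^sup>*\<close> of the circle are proportional on the pencils at \<open>P\<close> and \<open>Q\<close>, with a
  common factor \<open>\<alpha>\<close> because the line \<open>P Q\<close> is not a tangent. So \<open>X\<^sup>* - \<alpha> C\<^sup>*\<close> is a multiple of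
  \<open>P Q\<^sup>T + Q P\<^sup>T\<close>, and \<open>X\<^sup>* + \<alpha> \<rho> E\<close>, the sum of it and \<open>\<alpha> M M\<^sup>T\<close>, is the dual of the required conic.
\<close>

section \<open>Adjugates, bilinear forms and cross products\<close>

definition adjugate :: "'a::comm_ring_1^3^3 \<Rightarrow> 'a^3^3" where
  "adjugate A = vector
     [vector [A$2$2 * A$3$3 - A$2$3 * A$3$2, A$1$3 * A$3$2 - A$1$2 * A$3$3, A$1$2 * A$2$3 - A$1$3 * A$2$2],
      vector [A$2$3 * A$3$1 - A$2$1 * A$3$3, A$1$1 * A$3$3 - A$1$3 * A$3$1, A$1$3 * A$2$1 - A$1$1 * A$2$3],
      vector [A$2$1 * A$3$2 - A$2$2 * A$3$1, A$1$2 * A$3$1 - A$1$1 * A$3$2, A$1$1 * A$2$2 - A$1$2 * A$2$1]]"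

definition bil :: "complex^3^3 \<Rightarrow> complex^3 \<Rightarrow> complex^3 \<Rightarrow> complex" where
  "bil S u v = scalar_product u (S *v v)"

lemmas coords = bil_def scalar_product_def matrix_vector_mult_def cross_def adjugate_def sum_3
  vec_eq_iff forall_3 det_3

lemma symmetric_entries:
  assumes "transpose A = (A :: 'a^3^3)"
  shows "A$2$1 = A$1$2" "A$3$1 = A$1$3" "A$3$2 = A$2$3"
proof -
  have "A$j$i = A$i$j" for i j
    using arg_cong[OF assms, of "\<lambda>B. B$i$j"] by (simp add: transpose_def)
  then show "A$2$1 = A$1$2" "A$3$1 = A$1$3" "A$3$2 = A$2$3" by this+
qed

lemma mult_adjugate_vec: "A *v (adjugate A *v l) = det A *s (l :: 'a::comm_ring_1^3)"
  by (simp add: coords algebra_simps)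

lemma adjugate_mult_vec: "adjugate A *v (A *v l) = det A *s (l :: 'a::comm_ring_1^3)"
  by (simp add: coords algebra_simps)

lemma adjugate_adjugate: "(adjugate (adjugate A)) $ i $ j = det A * (A :: 'a::comm_ring_1^3^3) $ i $ j"
proof -
  have "\<forall>i j. (adjugate (adjugate A)) $ i $ j = det A * A $ i $ j"
    by (simp add: coords algebra_simps)
  then show ?thesis by blast
qed

text \<open>The adjugate acts on joins as \<open>A\<close> acts on points, since its entries are the
  2 by 2 minors of \<open>A\<close>. For the identity matrix this is Lagrange's identity for cross
  products.\<close>

lemma bil_adjugate_cross:
  assumes "transpose A = A"
  shows "bil (adjugate A) (cross u v) (cross w z) = bil A u w * bil A v z - bil A u z * bil A v w"
  by (simp add: coords symmetric_entries[OF assms]) algebra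

lemma cross_mult_vec:
  assumes "transpose A = A"
  shows "cross (A *v u) (A *v v) = adjugate A *v cross u v"
  by (simp add: coords symmetric_entries[OF assms] algebra_simps)

lemma bil_sym:
  assumes "transpose A = A"
  shows "bil A u v = bil A v u"
  by (simp add: coords symmetric_entries[OF assms]) algebra

lemma transpose_adjugate: "transpose (adjugate A) = adjugate (transpose A)"
  by (simp add: coords transpose_def)

lemma cross_eq_0_imp:
  assumes "cross u v = 0" "v \<noteq> 0"
  obtains k where "u = k *s v"
proof -
  have e: "u$2 * v$3 = u$3 * v$2" "u$3 * v$1 = u$1 * v$3" "u$1 * v$2 = u$2 * v$1"
    using assms(1) by (simp_all add: coords)
  consider "v$1 \<noteq> 0" | "v$2 \<noteq> 0" | "v$3 \<noteq> 0"
    using assms(2) by (auto simp: vec_eq_iff forall_3)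
  then show ?thesis
  proof cases
    case 1
    show ?thesis by (rule that[of "u$1 / v$1"]) (use 1 e in \<open>simp add: vec_eq_iff forall_3 field_simps\<close>)
  next
    case 2
    show ?thesis by (rule that[of "u$2 / v$2"]) (use 2 e in \<open>simp add: vec_eq_iff forall_3 field_simps\<close>)
  next
    case 3
    show ?thesis by (rule that[of "u$3 / v$3"]) (use 3 e in \<open>simp add: vec_eq_iff forall_3 field_simps\<close>)
  qed
qed

lemma cross_cross_left: "cross p (cross u v) = scalar_product p v *s u - scalar_product p u *s v"
  by (simp add: coords algebra_simps)

lemma incident_imp_cross:
  assumes "incident p l" "p \<noteq> 0"
  obtains q where "l = cross p q"
proof -
  obtain w where w: "scalar_product p w = 1"
  proof -
    consider "p$1 \<noteq> 0" | "p$2 \<noteq> 0" | "p$3 \<noteq> 0"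
      using assms(2) by (auto simp: vec_eq_iff forall_3)
    then show ?thesis
    proof cases
      case 1
      show ?thesis by (rule that[of "vector [1 / p$1, 0, 0]"]) (use 1 in \<open>simp add: coords\<close>)
    next
      case 2
      show ?thesis by (rule that[of "vector [0, 1 / p$2, 0]"]) (use 2 in \<open>simp add: coords\<close>)
    next
      case 3
      show ?thesis by (rule that[of "vector [0, 0, 1 / p$3]"]) (use 3 in \<open>simp add: coords\<close>)
    qed
  qed
  \<comment> \<open>With \<open>w\<close> normalized to pair to 1 with \<open>p\<close>, the second
    point is the intersection of \<open>l\<close> with the auxiliary line \<open>w\<close>.\<close>
  have "l = cross p (cross l w)"
    using assms(1) w by (simp add: cross_cross_left incident_def)
  then show ?thesis by (rule that)
qed

section \<open>Tangents and the dual conic\<close>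

lemma nondeg_conicD:
  assumes "nondeg_conic A"
  shows "transpose A = A" "det A \<noteq> 0"
  using assms by (auto simp: nondeg_conic_def invertible_det_nz)

lemma bil_scale: "bil S (j *s u) (k *s v) = j * k * bil S u v"
  by (simp add: coords algebra_simps)

text \<open>The tangents are the zeros of the dual form: \<open>adjugate A\<close> inverts
  \<open>A\<close> up to the factor \<open>det A\<close>, so it recovers the point of contact as the
  pole of \<open>l\<close>. All tangency questions below become questions about dual forms.\<close>

lemma tangent_iff:
  assumes "nondeg_conic A"
  shows "tangent A l \<longleftrightarrow> l \<noteq> 0 \<and> bil (adjugate A) l l = 0"
proof
  assume "tangent A l"
  then obtain p k where p: "bil A p p = 0" and l: "l \<noteq> 0" "l = k *s (A *v p)"
    by (auto simp: tangent_def tangent_at_def on_conic_def proj_eq_def bil_def)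
  have "bil (adjugate A) l l = k * k * (det A * scalar_product (A *v p) p)"
    unfolding l(2) bil_scale by (simp add: bil_def adjugate_mult_vec) (simp add: coords algebra_simps)
  also have "scalar_product (A *v p) p = bil A p p"
    by (simp add: coords algebra_simps)
  finally show "l \<noteq> 0 \<and> bil (adjugate A) l l = 0" using l p by simp
next
  assume l: "l \<noteq> 0 \<and> bil (adjugate A) l l = 0"
  define p where "p = adjugate A *v l"
  have Ap: "A *v p = det A *s l" by (simp add: p_def mult_adjugate_vec)
  note d = nondeg_conicD(2)[OF assms]
  have ne: "A *v p \<noteq> 0" using Ap d l by simp
  then have "p \<noteq> 0" by auto
  moreover have "scalar_product p (A *v p) = det A * bil (adjugate A) l l"
    unfolding Ap by (simp add: p_def bil_def) (simp add: scalar_product_def sum_3 algebra_simps)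
  moreover have "l = (1 / det A) *s (A *v p)" using Ap d by simp
  ultimately show "tangent A l"
    using l ne unfolding tangent_def tangent_at_def on_conic_def proj_eq_def by auto
qed

text \<open>If \<open>p\<close> and \<open>q\<close> were conjugate, both would lie on both polars
  \<open>A *v p\<close> and \<open>A *v q\<close>. These meet in a single point \<open>m\<close>, so
  \<open>p\<close> and \<open>q\<close> would coincide. The lemma is used for dual conics as
  well.\<close>

lemma bil_conic_points_nonzero:
  assumes "nondeg_conic A" "bil A p p = 0" "bil A q q = 0" "cross p q \<noteq> 0"
  shows "bil A p q \<noteq> 0"
proof
  assume pq: "bil A p q = 0"
  note A = nondeg_conicD[OF assms(1)]
  define m where "m = cross (A *v p) (A *v q)"
  have "adjugate A *v cross p q \<noteq> 0"
    using mult_adjugate_vec[of A "cross p q"] A(2) assms(4) by auto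
  then have m: "m \<noteq> 0"
    unfolding m_def cross_mult_vec[OF A(1)] .
  have "cross p m = 0" "cross q m = 0"
    using assms(2,3) pq bil_sym[OF A(1), of p q]
    by (simp_all add: m_def cross_cross_left bil_def)
  then obtain j k where "p = j *s m" "q = k *s m"
    by (metis cross_eq_0_imp m)
  then have "cross p q = 0" by (simp add: coords)
  then show False using assms(4) by blast
qed

text \<open>Adds \<open>t\<close> times diag(1, 1, 0), the dual form of the pair of circle points.
  With varying \<open>t\<close> this gives the duals of a confocal family.\<close>

definition dual_shift :: "'a::comm_ring_1^3^3 \<Rightarrow> 'a \<Rightarrow> 'a^3^3" where
  "dual_shift S t = (\<chi> i j. S$i$j + (if i = j \<and> i \<noteq> 3 then t else 0))"

lemma bil_dual_shift: "bil (dual_shift S t) u v = bil S u v + t * (u$1 * v$1 + u$2 * v$2)"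
  by (simp add: coords dual_shift_def algebra_simps)

section \<open>Real conics: circles and ellipses\<close>

lemma cmat_dual_shift: "cmat (dual_shift S t) = dual_shift (cmat S) (complex_of_real t)"
  by (simp add: cmat_def dual_shift_def map_matrix_def vec_eq_iff forall_3)

lemma cmat_nth [simp]: "cmat A $ i $ j = complex_of_real (A $ i $ j)"
  by (simp add: cmat_def map_matrix_def)

lemma cmat_adjugate: "cmat (adjugate A) = adjugate (cmat A)"
  by (simp add: vec_eq_iff forall_3) (simp add: adjugate_def)

lemma hpt_nth [simp]: "hpt p $ 1 = complex_of_real (p$1)" "hpt p $ 2 = complex_of_real (p$2)"
    "hpt p $ 3 = 1"
  by (simp_all add: hpt_def)

lemma hpt_nonzero [simp]: "hpt p \<noteq> 0"
  by (simp add: vec_eq_iff forall_3)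

lemma cross_hpt_nonzero:
  assumes "P \<noteq> Q"
  shows "cross (hpt P) (hpt Q) \<noteq> 0"
proof
  assume "cross (hpt P) (hpt Q) = 0"
  then have "P$1 = Q$1" "P$2 = Q$2" by (auto simp: coords)
  then show False using assms by (simp add: vec_eq_iff forall_2)
qed

lemma bil_adjugate_circle:
  "bil (adjugate (cmat (circle M \<rho>))) u v =
     scalar_product (hpt M) u * scalar_product (hpt M) v - \<rho> * (u$1 * v$1 + u$2 * v$2)"
  by (simp add: coords circle_def algebra_simps power2_eq_square)

lemma nondeg_conic_circle:
  assumes "\<rho> \<noteq> 0"
  shows "nondeg_conic (cmat (circle M \<rho>))"
proof -
  have "det (cmat (circle M \<rho>)) = - complex_of_real \<rho>"
    by (simp add: det_3 circle_def power2_eq_square algebra_simps)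
  moreover have "transpose (cmat (circle M \<rho>)) = cmat (circle M \<rho>)"
    by (simp add: vec_eq_iff forall_3 transpose_def circle_def)
  ultimately show ?thesis
    using assms by (simp add: nondeg_conic_def invertible_det_nz)
qed

text \<open>This entry is the determinant of the quadratic part of \<open>X\<close>, and also the
  dual form at the line at infinity. If it vanished, the quadratic part would have a real null
  vector, which is a real point at infinity.\<close>

lemma ellipse_adjugate_33:
  assumes "ellipse X"
  shows "adjugate X $ 3 $ 3 \<noteq> 0"
proof
  assume 0: "adjugate X $ 3 $ 3 = 0"
  have noninf: "v = 0" if "v$3 = 0" "scalar_product v (X *v v) = 0" for v :: "real^3"
  proof (rule ccontr)
    assume "v \<noteq> 0"
    then have "cvec v \<noteq> 0" by (simp add: cvec_def vec_eq_iff)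
    moreover have "scalar_product (cvec v) (cmat X *v cvec v) = scalar_product v (X *v v)"
      by (simp add: coords cvec_def)
    ultimately have "on_conic (cmat X) (cvec v)" using that by (simp add: on_conic_def)
    then show False using assms that by (auto simp: ellipse_def)
  qed
  have "transpose (cmat X) = cmat X" using assms by (simp add: ellipse_def nondeg_conic_def)
  from symmetric_entries[OF this] have X21: "X$2$1 = X$1$2" by simp
  then have det: "X$1$1 * X$2$2 = X$1$2 * X$1$2" using 0 by (simp add: adjugate_def)
  \<comment> \<open>A kernel vector of the singular quadratic part. If it is zero, then
    \<open>X$1$1 = 0\<close> and the first coordinate direction is a null vector instead.\<close>
  have "vector [X$1$2, - X$1$1, 0] = (0 :: real^3)"
  proof (rule noninf)
    have "X$1$2 * (X$1$1 * X$1$2 - X$1$2 * X$1$1) - X$1$1 * (X$1$2 * X$1$2 - X$1$1 * X$2$2) = 0"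
      using det by simp
    then show "scalar_product (vector [X$1$2, - X$1$1, 0]) (X *v vector [X$1$2, - X$1$1, 0]) = 0"
      by (simp add: coords X21 algebra_simps)
  qed simp
  then have "X$1$1 = 0" by (simp add: vec_eq_iff forall_3)
  then have "vector [1, 0, 0] = (0 :: real^3)"
    by (intro noninf) (simp_all add: coords)
  then show False by (simp add: vec_eq_iff forall_3)
qed

section \<open>Confocality as a linear relation between dual conics\<close>

lemma quadratic_factorization:
  fixes a b c :: complex
  assumes "a \<noteq> 0"
  obtains r s where "b = - a * (r + s)" "c = a * (r * s)"
proof -
  define w where "w = csqrt (b\<^sup>2 - 4 * a * c)"
  have w: "w\<^sup>2 = b\<^sup>2 - 4 * a * c" by (simp add: w_def)
  define r s where "r = (- b + w) / (2 * a)" and "s = (- b - w) / (2 * a)"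
  have rs: "2 * a * r = - b + w" "2 * a * s = - b - w"
    using assms by (simp_all add: r_def s_def)
  show ?thesis
  proof (rule that)
    have "2 * b = 2 * (- a * (r + s))" using rs by algebra
    then show "b = - a * (r + s)" by simp
    have "4 * a * c = (- b + w) * (- b - w)" using w by (simp add: power2_eq_square algebra_simps)
    also have "\<dots> = 4 * a * (a * (r * s))" unfolding rs[symmetric] by (simp add: algebra_simps)
    finally show "c = a * (r * s)" using assms by simp
  qed
qed

text \<open>The set of roots suffices, without multiplicities: a single root of a quadratic with
  nonzero leading coefficient is a double root.\<close>

lemma quadratics_same_roots:
  fixes a b c a' b' c' :: complex
  assumes "a \<noteq> 0" "a' \<noteq> 0"
    and roots: "\<And>z. a * z\<^sup>2 + b * z + c = 0 \<longleftrightarrow> a' * z\<^sup>2 + b' * z + c' = 0"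
  shows "a * b' = a' * b" "a * c' = a' * c"
proof -
  obtain r s where rs: "b = - a * (r + s)" "c = a * (r * s)"
    using quadratic_factorization[OF assms(1)] .
  obtain r' s' where rs': "b' = - a' * (r' + s')" "c' = a' * (r' * s')"
    using quadratic_factorization[OF assms(2)] .
  have "a * z\<^sup>2 + b * z + c = a * ((z - r) * (z - s))"
    "a' * z\<^sup>2 + b' * z + c' = a' * ((z - r') * (z - s'))" for z
    by (simp_all add: rs rs' power2_eq_square algebra_simps)
  then have "z = r \<or> z = s \<longleftrightarrow> z = r' \<or> z = s'" for z
    using roots[of z] assms(1,2) by simp
  then have "(r = r' \<and> s = s') \<or> (r = s' \<and> s = r')" by metis
  then show "a * b' = a' * b" "a * c' = a' * c" by (auto simp: rs rs')
qed

text \<open>On the lines through \<open>circ_I\<close> each dual form is a quadratic in one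
  parameter. Equal roots make the two quadratics proportional, and diag(1, 1, 0) spans the part of a
  symmetric matrix that they do not see.\<close>

lemma confocal_dual:
  assumes X: "nondeg_conic (cmat X)" "adjugate X $ 3 $ 3 \<noteq> 0" and R: "nondeg_conic (cmat R)"
    and conf: "confocal (cmat X) (cmat R)"
  obtains k \<mu> where "k \<noteq> 0"
    "\<And>i j. adjugate R $ i $ j = k * adjugate X $ i $ j + (if i = j \<and> i \<noteq> 3 then \<mu> else 0)"
proof -
  have tan: "tangent (cmat X) l \<longleftrightarrow> tangent (cmat R) l" if "incident circ_I l" for l
    using conf that by (auto simp: confocal_def isotropic_tangents_def)
  \<comment> \<open>the lines through \<open>circ_I\<close> other than the line at infinity\<close>
  define l where "l z = (vector [1, \<i>, z] :: complex^3)" for z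
  have bil_l: "bil (cmat S) (l z) (l z) =
      S$3$3 * z\<^sup>2 + (2 * (S$1$3 + \<i> * S$2$3)) * z + (S$1$1 - S$2$2 + 2 * \<i> * S$1$2)"
    if "transpose (cmat S) = cmat S" for S :: "real^3^3" and z :: complex
  proof -
    note se = symmetric_entries[OF that, unfolded cmat_nth]
    show ?thesis
      by (simp add: coords l_def se algebra_simps power2_eq_square)
  qed
  have sX: "transpose (cmat (adjugate X)) = cmat (adjugate X)"
    and sR: "transpose (cmat (adjugate R)) = cmat (adjugate R)"
    using nondeg_conicD(1)[OF X(1)] nondeg_conicD(1)[OF R] by (simp_all add: cmat_adjugate transpose_adjugate)
  have inf: "bil (cmat S) (vector [0, 0, 1]) (vector [0, 0, 1]) = S$3$3" for S
    by (simp add: coords)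
  have "incident circ_I (vector [0, 0, 1])" "(vector [0, 0, 1] :: complex^3) \<noteq> 0"
    by (simp_all add: incident_def circ_I_def coords)
  \<comment> \<open>The line at infinity passes through \<open>circ_I\<close>, so it is tangent to
    \<open>R\<close> only if it is tangent to \<open>X\<close>. This keeps both quadratics at degree
    exactly 2.\<close>
  then have R33: "adjugate R $ 3 $ 3 \<noteq> 0"
    using tan[of "vector [0, 0, 1]"] X(2)
    by (simp add: tangent_iff[OF X(1)] tangent_iff[OF R] inf flip: cmat_adjugate)
  have "incident circ_I (l z)" "l z \<noteq> 0" for z
    by (simp_all add: incident_def circ_I_def coords l_def)
  then have "bil (cmat (adjugate X)) (l z) (l z) = 0 \<longleftrightarrow> bil (cmat (adjugate R)) (l z) (l z) = 0" for z :: complex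
    using tan[of "l z"] by (simp add: tangent_iff[OF X(1)] tangent_iff[OF R] flip: cmat_adjugate)
  note roots = this[unfolded bil_l[OF sX] bil_l[OF sR]]
  let ?X = "adjugate X" and ?R = "adjugate R"
  have "?X$3$3 * (2 * (?R$1$3 + \<i> * ?R$2$3)) = ?R$3$3 * (2 * (?X$1$3 + \<i> * ?X$2$3))"
    "?X$3$3 * (?R$1$1 - ?R$2$2 + 2 * \<i> * ?R$1$2) = ?R$3$3 * (?X$1$1 - ?X$2$2 + 2 * \<i> * ?X$1$2)"
    using quadratics_same_roots[OF _ _ roots] X(2) R33 by simp_all
  \<comment> \<open>The matrices are real, so real and imaginary parts can be compared
    separately.\<close>
  then have eqs: "?X$3$3 * ?R$1$3 = ?R$3$3 * ?X$1$3" "?X$3$3 * ?R$2$3 = ?R$3$3 * ?X$2$3"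
    "?X$3$3 * (?R$1$1 - ?R$2$2) = ?R$3$3 * (?X$1$1 - ?X$2$2)" "?X$3$3 * ?R$1$2 = ?R$3$3 * ?X$1$2"
    by (simp_all add: complex_eq_iff)
  define k where "k = ?R$3$3 / ?X$3$3"
  define \<mu> where "\<mu> = ?R$1$1 - k * ?X$1$1"
  have 1: "?R$1$3 = k * ?X$1$3" "?R$2$3 = k * ?X$2$3" "?R$1$2 = k * ?X$1$2" "?R$3$3 = k * ?X$3$3"
    "?R$1$1 = k * ?X$1$1 + \<mu>" "?R$2$2 = k * ?X$2$2 + \<mu>"
    using X(2) eqs by (simp_all add: k_def \<mu>_def field_simps)
  note se = symmetric_entries[OF sX, unfolded cmat_nth of_real_eq_iff]
    symmetric_entries[OF sR, unfolded cmat_nth of_real_eq_iff]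
  show ?thesis
  proof (rule that)
    show "k \<noteq> 0" using X(2) R33 by (simp add: k_def)
    have "\<forall>i j. ?R$i$j = k * ?X$i$j + (if i = j \<and> i \<noteq> 3 then \<mu> else 0)"
      by (simp add: forall_3 1 se)
    then show "?R$i$j = k * ?X$i$j + (if i = j \<and> i \<noteq> 3 then \<mu> else 0)" for i j by blast
  qed
qed

section \<open>Dual forms on the pencil of lines through a point\<close>

lemma scalar_product_cross_cross:
  "scalar_product (cross u v) (cross w z) =
     scalar_product u w * scalar_product v z - scalar_product u z * scalar_product v w"
  by (simp add: coords) algebra

lemma incident_cross [simp]: "incident p (cross p q)" "incident q (cross p q)"
  by (simp_all add: incident_def coords algebra_simps)

lemma cross_scale: "cross (j *s u) (k *s v) = (j * k) *s cross u v"
  by (simp add: coords algebra_simps)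

lemma cross_cross_right: "cross (cross u v) w = scalar_product u w *s v - scalar_product v w *s u"
  by (simp add: coords algebra_simps)

lemma scalar_product_commute: "scalar_product u v = scalar_product v (u :: complex^3)"
  by (simp add: scalar_product_def mult.commute)

lemma scalar_product_scale: "scalar_product (k *s u) v = k * scalar_product u (v :: complex^3)"
  by (simp add: scalar_product_def sum_distrib_left mult.assoc)

lemma bil_lincomb:
  assumes "transpose S = S"
  shows "bil S (x *s u + y *s v) (x *s u + y *s v) =
    x\<^sup>2 * bil S u u + 2 * x * y * bil S u v + y\<^sup>2 * bil S v v"
  by (simp add: coords symmetric_entries[OF assms] power2_eq_square algebra_simps)

text \<open>Taking the adjugate twice returns the matrix up to its determinant, so proportional
  duals come from proportional conics.\<close>

lemma same_conicI:
  assumes AB: "nondeg_conic A" "nondeg_conic B"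
    and t: "t \<noteq> 0" "\<And>i j. adjugate A $ i $ j = t * adjugate B $ i $ j"
  shows "same_conic A B"
proof -
  have "adjugate (adjugate A) $ i $ j = t\<^sup>2 * adjugate (adjugate B) $ i $ j" for i j
  proof -
    have "\<forall>i j. adjugate (adjugate A) $ i $ j = t\<^sup>2 * adjugate (adjugate B) $ i $ j"
      unfolding adjugate_def[of "adjugate A"] adjugate_def[of "adjugate B"]
      by (simp add: forall_3 t(2) power2_eq_square algebra_simps)
    then show ?thesis by blast
  qed
  then have "det A * A$i$j = t\<^sup>2 * det B * B$i$j" for i j
    by (simp add: adjugate_adjugate mult.assoc)
  then have "A$i$j = (t\<^sup>2 * det B / det A) * B$i$j" for i j
    using nondeg_conicD(2)[OF AB(1)] by (simp add: field_simps)
  then show ?thesis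
    unfolding same_conic_def
    using t(1) nondeg_conicD(2)[OF AB(1)] nondeg_conicD(2)[OF AB(2)]
    by (intro exI[of _ "t\<^sup>2 * det B / det A"]) simp
qed

text \<open>Write \<open>l\<close> as the join of \<open>p\<close> and \<open>w\<close>. Since
  \<open>p\<close> is on the conic, the dual form at \<open>l\<close> is minus the square of
  \<open>bil A p w\<close>. The meet of the polars of \<open>p\<close> and \<open>q\<close> pairs
  with \<open>l\<close> to the same number, up to sign and the factor
  \<open>bil A p q\<close>.\<close>

lemma dual_form_on_tangent_pencil:
  assumes A: "transpose A = A" and p: "bil A p p = 0" "p \<noteq> 0" and l: "incident p l"
  shows "(bil A p q)\<^sup>2 * bil (adjugate A) l l = - (scalar_product (cross (A *v p) (A *v q)) l)\<^sup>2"
proof -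
  obtain w where w: "l = cross p w" using incident_imp_cross[OF l p(2)] .
  have "scalar_product (A *v u) v = bil A u v" for u v
    using bil_sym[OF A, of u v] by (simp add: bil_def scalar_product_def mult.commute)
  then have "scalar_product (cross (A *v p) (A *v q)) l = - bil A p w * bil A p q"
    by (simp add: w scalar_product_cross_cross p bil_sym[OF A, of q p])
  moreover have "bil (adjugate A) l l = - (bil A p w)\<^sup>2"
    by (simp add: w bil_adjugate_cross[OF A] p bil_sym[OF A, of w p] power2_eq_square)
  ultimately show ?thesis by (simp add: power_mult_distrib)
qed

lemma proj_eq_refl: "u \<noteq> 0 \<Longrightarrow> proj_eq u u"
  unfolding proj_eq_def by (metis vector_smult_lid)

lemma proj_eq_sym: "proj_eq u v \<Longrightarrow> proj_eq v u"
proof -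
  assume "proj_eq u v"
  then obtain k where k: "u \<noteq> 0" "v \<noteq> 0" "u = k *s v" unfolding proj_eq_def by blast
  then have "k \<noteq> 0" by auto
  then have "v = (1 / k) *s u" using k by simp
  then show ?thesis using k unfolding proj_eq_def by blast
qed

lemma proj_eq_trans: "proj_eq u v \<Longrightarrow> proj_eq v w \<Longrightarrow> proj_eq u w"
  unfolding proj_eq_def by (metis vector_smult_assoc)

text \<open>
  A tangent \<open>a\<close> that is a double zero of the dual form on the pencil at \<open>p\<close> is conjugate to every line
  of the pencil, so that its point of contact is \<open>p\<close>.
\<close>

lemma on_conic_if_unique_tangent:
  assumes C: "nondeg_conic C" and p: "p \<noteq> 0" and a: "tangent C a" "incident p a"
    and unique: "\<And>l. tangent C l \<Longrightarrow> incident p l \<Longrightarrow> proj_eq l a"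
  shows "on_conic C p"
proof -
  let ?B = "bil (adjugate C)"
  note sC = nondeg_conicD(1)[OF C]
  have sB: "transpose (adjugate C) = adjugate C" by (simp add: transpose_adjugate sC)
  have a': "a \<noteq> 0" "?B a a = 0" using a by (simp_all add: tangent_iff[OF C])
  have conj: "?B e a = 0" if e: "incident p e" for e
  proof (rule ccontr)
    assume ea: "?B e a \<noteq> 0"
    then have e0: "e \<noteq> 0" by (auto simp: bil_def scalar_product_def)
    have proportional: "?B e a = 0" if "e = j *s a" for j
      using a'(2) bil_scale[of "adjugate C" j a 1 a] that by simp
    have ee: "?B e e \<noteq> 0"
      using unique[OF _ e] proportional ea e0 by (auto simp: tangent_iff[OF C] proj_eq_def)
    \<comment> \<open>the second zero of the dual form on the pencil spanned by \<open>a\<close> and \<open>e\<close>\<close>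
    define l where "l = (?B e e) *s a + (- 2 * ?B e a) *s e"
    have "incident p l"
      using a(2) e by (simp add: incident_def l_def scalar_product_def sum_3) algebra
    moreover have "?B l l = 0"
      unfolding l_def bil_lincomb[OF sB] by (simp add: a' bil_sym[OF sB, of a e] power2_eq_square)
    ultimately have "l = 0 \<or> proj_eq l a" using unique by (auto simp: tangent_iff[OF C])
    then obtain j where j: "l = j *s a"
      by (auto simp: proj_eq_def intro: that[of 0])
    have "e = ((?B e e - j) / (2 * ?B e a)) *s a"
      using ea j by (simp add: l_def vec_eq_iff field_simps)
    then show False using proportional ea by blast
  qed
  define p0 where "p0 = adjugate C *v a"
  \<comment> \<open>The triple product is cyclic, so conjugacy of \<open>a\<close> to every join of
    \<open>p\<close> and \<open>w\<close> says that \<open>cross p0 p\<close> is orthogonal to every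
    \<open>w\<close>.\<close>
  have "scalar_product w (cross p0 p) = 0" for w
  proof -
    have "scalar_product w (cross p0 p) = bil (adjugate C) (cross p w) a"
      by (simp add: bil_def flip: p0_def) (simp add: coords algebra_simps)
    then show ?thesis by (simp add: conj)
  qed
  from this[of "vector [1,0,0]"] this[of "vector [0,1,0]"] this[of "vector [0,0,1]"]
  have "cross p0 p = 0" by (simp add: scalar_product_def sum_3 vec_eq_iff forall_3)
  then obtain t where t: "p0 = t *s p" using p cross_eq_0_imp by blast
  have Cp0: "C *v p0 = det C *s a" by (simp add: p0_def mult_adjugate_vec)
  then have "t \<noteq> 0" using t a'(1) nondeg_conicD(2)[OF C] by auto
  moreover have "bil C p0 p0 = det C * ?B a a"
    by (simp add: bil_def Cp0) (simp add: p0_def scalar_product_def sum_3 algebra_simps)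
  ultimately have "bil C p p = 0" using t a'(2) by (simp add: bil_scale)
  then show ?thesis using p by (simp add: on_conic_def bil_def)
qed

text \<open>Proportional dual forms have the same zeros, so both conics have the same tangents
  through \<open>p\<close>. A double tangent is the only one, which yields the limit
  condition.\<close>

lemma touches_both_if_proportional:
  assumes A: "nondeg_conic A" and C: "nondeg_conic C" and p: "p \<noteq> 0"
    and proportional: "\<And>l. incident p l \<Longrightarrow> k * bil (adjugate A) l l = c * bil (adjugate C) l l"
    and kc: "k \<noteq> 0" "c \<noteq> 0"
    and ab: "tangents_from A p a b"
  shows "touches_both C p a b"
proof -
  have iff: "tangent A l \<longleftrightarrow> tangent C l" if "incident p l" for l
    using proportional[OF that] kc by (auto simp: tangent_iff[OF A] tangent_iff[OF C])
  have a: "tangent A a" "incident p a" and b: "tangent A b" "incident p b"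
    using ab proj_eq_refl unfolding tangents_from_def by blast+
  have "on_conic C p" if "proj_eq a b"
  proof (rule on_conic_if_unique_tangent[OF C p])
    show "tangent C a" "incident p a" using a iff by auto
    fix l assume "tangent C l" "incident p l"
    then show "proj_eq l a"
      using ab iff \<open>proj_eq a b\<close> proj_eq_sym proj_eq_trans unfolding tangents_from_def by blast
  qed
  then show ?thesis using a b iff by (auto simp: touches_both_def)
qed

section \<open>From a confocal conic to the circle\<close>

lemma confocal_tangents_touch_circle:
  fixes X R :: "real^3^3" and P Q M :: "real^2"
  assumes "ellipse X"
    and R: "nondeg_conic (cmat R)" "confocal (cmat X) (cmat R)" "\<not> same_conic (cmat R) (cmat X)"
    and PQ: "P \<noteq> Q" "tangent_at (cmat R) (hpt P) tP" "tangent_at (cmat R) (hpt Q) tQ"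
    and ab: "tangents_from (cmat X) (hpt P) a b" and cd: "tangents_from (cmat X) (hpt Q) c d"
  shows "meet tP tQ \<noteq> 0"
    and "proj_eq (hpt M) (meet tP tQ) \<Longrightarrow>
      \<exists>\<rho>. \<rho> \<noteq> 0 \<and> ((\<exists>z. on_conic (cmat R) (hpt z) \<and> \<not> lies_inside X z) \<longrightarrow> \<rho> > 0) \<and>
        touches_both (cmat (circle M \<rho>)) (hpt P) a b \<and> touches_both (cmat (circle M \<rho>)) (hpt Q) c d"
proof -
  let ?R = "cmat R" and ?X = "cmat X" and ?P = "hpt P" and ?Q = "hpt Q"
  have X: "nondeg_conic ?X" using assms(1) by (simp add: ellipse_def)
  note sR = nondeg_conicD(1)[OF R(1)]
  define m where "m = cross (?R *v ?P) (?R *v ?Q)"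
  obtain i j where tP: "tP = i *s (?R *v ?P)" "tP \<noteq> 0" and tQ: "tQ = j *s (?R *v ?Q)" "tQ \<noteq> 0"
    using PQ by (auto simp: tangent_at_def proj_eq_def)
  then have ij: "i \<noteq> 0" "j \<noteq> 0" by auto
  have meet: "meet tP tQ = (i * j) *s m" by (simp add: tP tQ m_def cross_scale)
  \<comment> \<open>The intersection \<open>m\<close> of the two tangents is the pole of the line
    through \<open>P\<close> and \<open>Q\<close>.\<close>
  have "adjugate ?R *v cross ?P ?Q \<noteq> 0"
    using mult_adjugate_vec[of ?R "cross ?P ?Q"] nondeg_conicD(2)[OF R(1)] cross_hpt_nonzero[OF PQ(1)]
    by auto
  then have "m \<noteq> 0" unfolding m_def cross_mult_vec[OF sR] .
  then show "meet tP tQ \<noteq> 0" using meet ij by simp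
  assume M: "proj_eq (hpt M) (meet tP tQ)"
  then obtain \<kappa> where "hpt M = \<kappa> *s m" unfolding proj_eq_def meet by (metis vector_smult_assoc)
  moreover from this have "\<kappa> * m$3 = 1" by (metis hpt_nth(3) vector_smult_component)
  ultimately have m3: "m$3 \<noteq> 0" "m = m$3 *s hpt M"
    by (auto simp: mult.commute[of "m$3"])
  have on: "bil ?R ?P ?P = 0" "bil ?R ?Q ?Q = 0"
    using PQ by (simp_all add: tangent_at_def on_conic_def bil_def)
  have "bil ?R ?P ?Q \<noteq> 0"
    using bil_conic_points_nonzero[OF R(1) on] cross_hpt_nonzero[OF PQ(1)] .
  \<comment> \<open>Real \<open>s\<close> and \<open>n\<close> make \<open>c0\<close> a negative
    real number, which later decides the sign of \<open>\<rho>\<close>.\<close>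
  moreover have "Im (bil ?R ?P ?Q) = 0" "Im (m$3) = 0"
    by (simp_all add: m_def coords)
  ultimately obtain s n where s: "bil ?R ?P ?Q = complex_of_real s" "s \<noteq> 0"
      and n: "m$3 = complex_of_real n" "n \<noteq> 0"
    using m3(1) by (metis complex_is_Real_iff of_real_0 Reals_cases)
  obtain k \<mu> where k: "k \<noteq> 0"
    and dual: "\<And>i j. adjugate R $ i $ j = k * adjugate X $ i $ j + (if i = j \<and> i \<noteq> 3 then \<mu> else 0)"
    using confocal_dual[OF X ellipse_adjugate_33[OF assms(1)] R(1,2)] by blast
  have dual_bil: "bil (adjugate ?R) u v = k * bil (adjugate ?X) u v + \<mu> * (u$1 * v$1 + u$2 * v$2)" for u v
    unfolding cmat_adjugate[symmetric] bil_def
    by (simp add: scalar_product_def matrix_vector_mult_def sum_3 dual algebra_simps)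
  have \<mu>: "\<mu> \<noteq> 0"
  proof
    assume "\<mu> = 0"
    then have "adjugate ?R $ i $ j = complex_of_real k * adjugate ?X $ i $ j" for i j
      unfolding cmat_adjugate[symmetric] using dual by simp
    then show False using same_conicI[OF R(1) X, of "complex_of_real k"] k R(3) by simp
  qed
  \<comment> \<open>On both pencils the dual of \<open>R\<close> is \<open>c0\<close> times the
    square of the pairing with \<open>M\<close>. Subtracting \<open>\<mu>\<close> times diag(1, 1,
    0) leaves \<open>c0\<close> times the dual circle exactly if
    \<open>c0 * \<rho> = \<mu>\<close>.\<close>
  define c0 where "c0 = - (n / s)\<^sup>2"
  define \<rho> where "\<rho> = \<mu> / c0"
  have c0: "c0 < 0" using n s by (simp add: c0_def)
  have \<rho>: "\<rho> \<noteq> 0" using \<mu> c0 by (simp add: \<rho>_def)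
  have C: "nondeg_conic (cmat (circle M \<rho>))" by (rule nondeg_conic_circle[OF \<rho>])
  have proportional: "k * bil (adjugate ?X) l l = c0 * bil (adjugate (cmat (circle M \<rho>))) l l"
    if "incident ?P l \<or> incident ?Q l" for l
  proof -
    \<comment> \<open>Exchanging \<open>P\<close> and \<open>Q\<close> only changes the sign of
      \<open>m\<close>, and only its square enters. So one constant serves both pencils.\<close>
    have "cross (?R *v ?Q) (?R *v ?P) = - m" by (simp add: m_def coords)
    then have "(scalar_product (cross (?R *v ?Q) (?R *v ?P)) l)\<^sup>2 = (scalar_product m l)\<^sup>2"
      by (simp add: scalar_product_def sum_negf)
    then have "(bil ?R ?P ?Q)\<^sup>2 * bil (adjugate ?R) l l = - (scalar_product m l)\<^sup>2"
      using that dual_form_on_tangent_pencil[OF sR on(1) hpt_nonzero, of l ?Q]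
        dual_form_on_tangent_pencil[OF sR on(2) hpt_nonzero, of l ?P]
      by (auto simp: m_def bil_sym[OF sR, of ?Q ?P])
    moreover have "scalar_product m l = n * scalar_product (hpt M) l"
      by (subst m3(2)) (simp add: n scalar_product_def sum_distrib_left mult.assoc)
    ultimately have "complex_of_real s ^ 2 * bil (adjugate ?R) l l = - (n * scalar_product (hpt M) l)\<^sup>2"
      by (simp add: s)
    then have "bil (adjugate ?R) l l = c0 * (scalar_product (hpt M) l)\<^sup>2"
      using s(2) by (simp add: c0_def field_simps)
    moreover have "c0 * \<rho> = \<mu>" using c0 by (simp add: \<rho>_def)
    then have "complex_of_real c0 * complex_of_real \<rho> = \<mu>" by (metis of_real_mult)
    ultimately show ?thesis
      using dual_bil[of l l] by (simp add: bil_adjugate_circle power2_eq_square) algebra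
  qed
  \<comment> \<open>At a real tangent of \<open>X\<close> through a point of \<open>R\<close>, the
    dual of \<open>X\<close> vanishes and that of \<open>R\<close> is minus a real square. This
    forces \<open>\<mu>\<close> to be negative, like \<open>c0\<close>.\<close>
  have "\<rho> > 0" if "on_conic ?R (hpt z)" "\<not> lies_inside X z" for z
  proof -
    obtain l where l: "tangent ?X (cvec l)" "incident (hpt z) (cvec l)"
      using \<open>\<not> lies_inside X z\<close> by (auto simp: lies_inside_def)
    \<comment> \<open>The point at infinity of the tangent, a second real point on it.\<close>
    define w where "w = cross (cvec l) (vector [0, 0, 1])"
    have cl: "cvec l = cross (hpt z) w"
      using l(2) by (simp add: w_def cross_cross_left incident_def) (simp add: coords)
    have z: "bil ?R (hpt z) (hpt z) = 0" using that(1) by (simp add: on_conic_def bil_def)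
    have "Im (bil ?R (hpt z) w) = 0" by (simp add: w_def coords cvec_def)
    then obtain x where x: "bil ?R (hpt z) w = complex_of_real x"
      by (metis complex_is_Real_iff Reals_cases)
    have "bil (adjugate ?R) (cvec l) (cvec l) = - (complex_of_real x)\<^sup>2"
      by (simp add: cl bil_adjugate_cross[OF sR] z bil_sym[OF sR, of w "hpt z"] x power2_eq_square)
    moreover have "bil (adjugate ?X) (cvec l) (cvec l) = 0" and l0: "cvec l \<noteq> 0"
      using l(1) by (simp_all add: tangent_iff[OF X])
    ultimately have "complex_of_real (\<mu> * ((l$1)\<^sup>2 + (l$2)\<^sup>2)) = complex_of_real (- x\<^sup>2)"
      using dual_bil[of "cvec l" "cvec l"] by (simp add: cvec_def power2_eq_square)
    then have e: "\<mu> * ((l$1)\<^sup>2 + (l$2)\<^sup>2) = - x\<^sup>2" by (simp only: of_real_eq_iff)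
    have "(l$1)\<^sup>2 + (l$2)\<^sup>2 \<noteq> 0"
    proof
      assume "(l$1)\<^sup>2 + (l$2)\<^sup>2 = 0"
      then have "l$1 = 0" "l$2 = 0" by (simp_all add: sum_power2_eq_zero_iff)
      then have "cvec l = 0" using l(2) by (simp add: incident_def coords cvec_def)
      then show False using l0 by simp
    qed
    then have "(l$1)\<^sup>2 + (l$2)\<^sup>2 > 0" by (simp add: sum_power2_gt_zero_iff sum_power2_eq_zero_iff)
    moreover have "- x\<^sup>2 \<le> 0" by simp
    ultimately have "\<mu> \<le> 0" using e by (metis mult_pos_pos not_less)
    then show ?thesis using \<mu> c0 by (simp add: \<rho>_def divide_neg_neg)
  qed
  moreover have "touches_both (cmat (circle M \<rho>)) ?P a b"
    by (rule touches_both_if_proportional[OF X C hpt_nonzero proportional _ _ ab]) (use k c0 in auto)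
  moreover have "touches_both (cmat (circle M \<rho>)) ?Q c d"
    by (rule touches_both_if_proportional[OF X C hpt_nonzero proportional _ _ cd]) (use k c0 in auto)
  ultimately show "\<exists>\<rho>. \<rho> \<noteq> 0 \<and> ((\<exists>z. on_conic (cmat R) (hpt z) \<and> \<not> lies_inside X z) \<longrightarrow> \<rho> > 0) \<and>
        touches_both (cmat (circle M \<rho>)) (hpt P) a b \<and> touches_both (cmat (circle M \<rho>)) (hpt Q) c d"
    using \<rho> by blast
qed

section \<open>From the circle to a confocal conic\<close>

lemma nondeg_conic_adjugate:
  assumes "nondeg_conic A"
  shows "nondeg_conic (adjugate A)"
proof -
  note A = nondeg_conicD[OF assms]
  have "x = 0" if "adjugate A *v x = 0" for x
    using mult_adjugate_vec[of A x] that A(2) by simp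
  then have "invertible (adjugate A)"
    by (simp add: invertible_left_inverse matrix_left_invertible_ker)
  then show ?thesis by (simp add: nondeg_conic_def transpose_adjugate A)
qed

text \<open>If \<open>a\<close> and \<open>b\<close> differ, they span the pencil, and both dual
  forms are multiples of the product of the two coordinates. If they coincide, \<open>a\<close> is
  the polar of \<open>p\<close> for both conics, and both forms are multiples of the square of
  \<open>scalar_product q a\<close> at the join of \<open>p\<close> and \<open>q\<close>.\<close>

lemma dual_forms_proportional_on_pencil:
  assumes A: "nondeg_conic A" and C: "nondeg_conic C"
    and a: "tangent A a" "tangent C a" and b: "tangent A b" "tangent C b"
    and p: "tangents_meet A C a b p"
  obtains \<alpha> where "p \<noteq> 0" "\<alpha> \<noteq> 0"
    "\<And>l. incident p l \<Longrightarrow> bil (adjugate A) l l = \<alpha> * bil (adjugate C) l l"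
    "\<And>l. incident p l \<Longrightarrow> tangent A l \<Longrightarrow> proj_eq l a \<or> proj_eq l b"
proof (cases "proj_eq a b")
  case False
  have a0: "a \<noteq> 0" "bil (adjugate A) a a = 0" "bil (adjugate C) a a = 0"
    and b0: "b \<noteq> 0" "bil (adjugate A) b b = 0" "bil (adjugate C) b b = 0"
    using a b by (simp_all add: tangent_iff[OF A] tangent_iff[OF C])
  have ab: "cross a b \<noteq> 0"
    using False cross_eq_0_imp[of a b] a0 b0 by (auto simp: proj_eq_def)
  obtain j where j: "p = j *s cross a b" "p \<noteq> 0"
    using p False unfolding tangents_meet_def proj_eq_def by auto
  have lin: "\<exists>x y. l = x *s a + y *s b" if "incident p l" for l
  proof -
    have "incident (cross a b) l"
      using \<open>incident p l\<close> j by (auto simp: incident_def scalar_product_scale)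
    then obtain q where q: "l = cross (cross a b) q" using incident_imp_cross ab by blast
    have "l = (- scalar_product b q) *s a + scalar_product a q *s b"
      by (simp add: q cross_cross_right)
    then show ?thesis by blast
  qed
  let ?\<alpha> = "bil (adjugate A) a b" and ?\<gamma> = "bil (adjugate C) a b"
  have nz: "?\<alpha> \<noteq> 0" "?\<gamma> \<noteq> 0"
    using bil_conic_points_nonzero nondeg_conic_adjugate A C a0 b0 ab by blast+
  have sA: "transpose (adjugate A) = adjugate A" and sC: "transpose (adjugate C) = adjugate C"
    using nondeg_conic_adjugate A C nondeg_conicD(1) by blast+
  show ?thesis
  proof (rule that[OF j(2), of "?\<alpha> / ?\<gamma>"])
    show "?\<alpha> / ?\<gamma> \<noteq> 0" using nz by simp
    fix l assume "incident p l"
    then obtain x y where l: "l = x *s a + y *s b" using lin by blast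
    have A_l: "bil (adjugate A) l l = 2 * x * y * ?\<alpha>"
      unfolding l bil_lincomb[OF sA] using a0 b0 by simp
    moreover have "bil (adjugate C) l l = 2 * x * y * ?\<gamma>"
      unfolding l bil_lincomb[OF sC] using a0 b0 by simp
    ultimately show "bil (adjugate A) l l = ?\<alpha> / ?\<gamma> * bil (adjugate C) l l" using nz by simp
    assume "tangent A l"
    then have "l \<noteq> 0" "x = 0 \<or> y = 0" using A_l nz by (auto simp: tangent_iff[OF A])
    then show "proj_eq l a \<or> proj_eq l b" using l a0 b0 by (auto simp: proj_eq_def)
  qed
next
  case True
  then have "tangent_at A p a" "tangent_at C p a" using p by (auto simp: tangents_meet_def)
  then obtain s t where p0: "p \<noteq> 0" and pA: "bil A p p = 0" and pC: "bil C p p = 0"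
    and s: "a = s *s (A *v p)" and t: "a = t *s (C *v p)" and a0: "a \<noteq> 0"
    unfolding tangent_at_def on_conic_def proj_eq_def bil_def by blast
  have st: "s \<noteq> 0" "t \<noteq> 0" using s t a0 by auto
  note sA = nondeg_conicD(1)[OF A] and sC = nondeg_conicD(1)[OF C]
  have qa: "scalar_product q a = s * bil A q p" "scalar_product q a = t * bil C q p" for q
  proof -
    show "scalar_product q a = s * bil A q p"
      unfolding s bil_def by (simp add: scalar_product_def sum_3 algebra_simps)
    show "scalar_product q a = t * bil C q p"
      unfolding t bil_def by (simp add: scalar_product_def sum_3 algebra_simps)
  qed
  have form_A: "s\<^sup>2 * bil (adjugate A) (cross p q) (cross p q) = - (scalar_product q a)\<^sup>2" for q
    by (simp add: bil_adjugate_cross[OF sA] pA bil_sym[OF sA, of p q] qa(1) power2_eq_square)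
  have form_C: "t\<^sup>2 * bil (adjugate C) (cross p q) (cross p q) = - (scalar_product q a)\<^sup>2" for q
    by (simp add: bil_adjugate_cross[OF sC] pC bil_sym[OF sC, of p q] qa(2) power2_eq_square)
  show ?thesis
  proof (rule that[OF p0, of "(t / s)\<^sup>2"])
    show "(t / s)\<^sup>2 \<noteq> 0" using st by simp
    fix l assume "incident p l"
    then obtain q where l: "l = cross p q" using incident_imp_cross p0 by blast
    show "bil (adjugate A) l l = (t / s)\<^sup>2 * bil (adjugate C) l l"
      using form_A[of q] form_C[of q] st by (simp add: l field_simps)
    assume "tangent A l"
    then have l0: "l \<noteq> 0" "scalar_product q a = 0"
      using form_A[of q] by (auto simp: tangent_iff[OF A] l)
    moreover have "scalar_product p a = 0" using qa(1)[of p] pA by simp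
    ultimately have "cross l a = 0" by (simp add: l cross_cross_right)
    then show "proj_eq l a \<or> proj_eq l b"
      using cross_eq_0_imp[of l a] a0 l0 by (auto simp: proj_eq_def)
  qed
qed

text \<open>Cramer's rule: the sides of the triangle \<open>P\<close>, \<open>Q\<close>,
  \<open>M\<close> are the dual basis of its vertices, up to the determinant.\<close>

lemma triple_expansion:
  "scalar_product (cross P Q) M *s u = scalar_product u (cross Q M) *s P +
     scalar_product u (cross M P) *s Q + scalar_product u (cross P Q) *s M"
  by (simp add: coords algebra_simps)

lemma dual_triple_expansion:
  "scalar_product (cross P Q) M *s u = scalar_product u P *s cross Q M +
     scalar_product u Q *s cross M P + scalar_product u M *s cross P Q"
  by (simp add: coords algebra_simps)

lemma bil_polarization:
  assumes "transpose S = S" "bil S u u = 0" "bil S v v = 0" "bil S (u + v) (u + v) = 0"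
  shows "bil S u v = 0"
  using bil_lincomb[OF assms(1), of 1 u 1 v] assms(2-4) by simp

text \<open>The form diag(1, 1, 0) vanishes on isotropic lines, so a dual shift keeps the isotropic
  tangents.\<close>

lemma isotropic_coords:
  assumes "incident circ_I l \<or> incident circ_J l"
  shows "l$1 * l$1 + l$2 * l$2 = 0"
proof -
  have "l$1 * l$1 + l$2 * l$2 = (l$1 + \<i> * l$2) * (l$1 - \<i> * l$2)" by (simp add: algebra_simps)
  moreover have "l$1 + \<i> * l$2 = 0 \<or> l$1 - \<i> * l$2 = 0"
    using assms by (simp add: incident_def circ_I_def circ_J_def coords)
  ultimately show ?thesis by auto
qed

lemma real_ratio:
  assumes "x = \<alpha> * y" "y \<noteq> 0" "Im x = 0" "Im y = 0"
  shows "\<exists>r. \<alpha> = complex_of_real r"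
proof -
  have "\<alpha> = x / y" using assms by simp
  moreover have "x \<in> \<real>" "y \<in> \<real>" using assms by (simp_all add: complex_is_Real_iff)
  ultimately have "\<alpha> \<in> \<real>" by simp
  then show ?thesis by (auto elim: Reals_cases)
qed

lemma common_tangents_confocal_conic:
  fixes X :: "real^3^3" and M :: "real^2"
  assumes "ellipse X" and \<rho>: "\<rho> \<noteq> 0"
    and not_same: "\<not> same_conic (cmat X) (cmat (circle M \<rho>))"
    and tan: "\<forall>l\<in>{a, b, c, d}. tangent (cmat X) l \<and> tangent (cmat (circle M \<rho>)) l"
    and distinct: "\<not> proj_eq a c" "\<not> proj_eq a d" "\<not> proj_eq b c" "\<not> proj_eq b d"
    and P: "tangents_meet (cmat X) (cmat (circle M \<rho>)) a b P"
    and Q: "tangents_meet (cmat X) (cmat (circle M \<rho>)) c d Q"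
    and M: "\<not> incident (hpt M) (join P Q)"
  shows "\<exists>R. nondeg_conic R \<and> confocal (cmat X) R \<and> \<not> same_conic R (cmat X) \<and>
    tangent_at R P (join (hpt M) P) \<and> tangent_at R Q (join (hpt M) Q) \<and>
    (real_point P \<and> real_point Q \<longrightarrow> (\<exists>S :: real^3^3. R = cmat S))"
proof -
  let ?X = "cmat X" and ?C = "cmat (circle M \<rho>)"
  have X: "nondeg_conic ?X" using assms(1) by (simp add: ellipse_def)
  have C: "nondeg_conic ?C" by (rule nondeg_conic_circle[OF \<rho>])
  have sX: "transpose (adjugate ?X) = adjugate ?X" and sC: "transpose (adjugate ?C) = adjugate ?C"
    using nondeg_conic_adjugate X C nondeg_conicD(1) by blast+
  obtain \<alpha> where P0: "P \<noteq> 0" and \<alpha>: "\<alpha> \<noteq> 0"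
    and on_P: "\<And>l. incident P l \<Longrightarrow> bil (adjugate ?X) l l = \<alpha> * bil (adjugate ?C) l l"
    and tan_P: "\<And>l. incident P l \<Longrightarrow> tangent ?X l \<Longrightarrow> proj_eq l a \<or> proj_eq l b"
    using dual_forms_proportional_on_pencil[OF X C _ _ _ _ P] tan by auto
  obtain \<beta> where Q0: "Q \<noteq> 0"
    and on_Q': "\<And>l. incident Q l \<Longrightarrow> bil (adjugate ?X) l l = \<beta> * bil (adjugate ?C) l l"
    and tan_Q: "\<And>l. incident Q l \<Longrightarrow> tangent ?X l \<Longrightarrow> proj_eq l c \<or> proj_eq l d"
    using dual_forms_proportional_on_pencil[OF X C _ _ _ _ Q] tan by (metis insertCI)
  define f g h where "f = cross Q (hpt M)" and "g = cross (hpt M) P" and "h = cross P Q"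
  define \<delta> where "\<delta> = scalar_product h (hpt M)"
  have \<delta>: "\<delta> \<noteq> 0" using M by (simp add: \<delta>_def h_def incident_def scalar_product_commute)
  then have h0: "h \<noteq> 0" by (auto simp: \<delta>_def scalar_product_def)
  have inc: "incident P g" "incident P h" "incident Q f" "incident Q h"
    by (simp_all add: f_def g_def h_def)
  have pair: "scalar_product f P = \<delta>" "scalar_product f Q = 0" "scalar_product f (hpt M) = 0"
    "scalar_product g P = 0" "scalar_product g Q = \<delta>" "scalar_product g (hpt M) = 0"
    "scalar_product h P = 0" "scalar_product h Q = 0"
    by (simp_all add: \<delta>_def f_def g_def h_def) (simp_all add: coords algebra_simps)
  \<comment> \<open>A tangent through both \<open>P\<close> and \<open>Q\<close> would be one of
    \<open>a\<close>, \<open>b\<close> and also one of \<open>c\<close>, \<open>d\<close>.\<close>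
  have "\<not> tangent ?X h"
    using tan_P[OF inc(2)] tan_Q[OF inc(4)] distinct proj_eq_sym proj_eq_trans by blast
  then have Xh: "bil (adjugate ?X) h h \<noteq> 0" using h0 by (simp add: tangent_iff[OF X])
  then have "\<beta> = \<alpha>" using on_P[OF inc(2)] on_Q'[OF inc(4)] by auto
  note on_Q = on_Q'[unfolded this]
  have expand: "\<delta> *s u = scalar_product f u *s P + scalar_product g u *s Q + scalar_product h u *s hpt M" for u
    using triple_expansion[of P Q "hpt M" u]
    by (simp add: \<delta>_def f_def g_def h_def scalar_product_commute[of u])

  \<comment> \<open>\<open>T\<close> vanishes on both pencils. The sides \<open>g\<close>,
    \<open>h\<close> span the pencil at \<open>P\<close> and \<open>f\<close>, \<open>h\<close> that
    at \<open>Q\<close>, so by polarization only the value at the pair \<open>f\<close>,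
    \<open>g\<close> can survive.\<close>
  define T where "T = (\<chi> i j. adjugate ?X $ i $ j - \<alpha> * adjugate ?C $ i $ j)"
  have sT: "transpose T = T"
    using symmetric_entries[OF sX] symmetric_entries[OF sC]
    by (simp add: T_def transpose_def vec_eq_iff forall_3)
  have bil_T: "bil T u v = bil (adjugate ?X) u v - \<alpha> * bil (adjugate ?C) u v" for u v
    unfolding bil_def by (simp add: T_def scalar_product_def matrix_vector_mult_def sum_3 algebra_simps)
  have T0: "bil T l l = 0" if "incident P l \<or> incident Q l" for l
    using that on_P on_Q by (auto simp: bil_T)
  have inc_add: "incident p (u + v)" if "incident p u" "incident p v" for p u v
    using that by (simp add: incident_def scalar_product_def sum.distrib distrib_left)
  have T_pairs: "bil T g g = 0" "bil T h h = 0" "bil T f f = 0" "bil T g h = 0" "bil T f h = 0"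
    using T0 inc inc_add bil_polarization[OF sT] by simp_all
  define \<gamma> where "\<gamma> = bil T f g"
  have T_vec: "\<delta> *s (T *v f) = \<gamma> *s Q" "\<delta> *s (T *v g) = \<gamma> *s P" "T *v h = 0"
  proof -
    have e: "\<delta> *s (T *v u) = bil T f u *s P + bil T g u *s Q + bil T h u *s hpt M" for u
      unfolding expand bil_def ..
    show "\<delta> *s (T *v f) = \<gamma> *s Q" "\<delta> *s (T *v g) = \<gamma> *s P"
      unfolding e \<gamma>_def using T_pairs bil_sym[OF sT] by simp_all
    have "\<delta> *s (T *v h) = 0"
      unfolding e using T_pairs by simp
    then show "T *v h = 0" using \<delta> by simp
  qed
  have \<gamma>: "\<gamma> \<noteq> 0"
  proof
    assume "\<gamma> = 0"
    then have "T *v f = 0" "T *v g = 0" using T_vec \<delta> by simp_all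
    then have "bil T f v = 0" "bil T g v = 0" "bil T h v = 0" for v
      using T_vec bil_sym[OF sT, of _ v] by (simp_all add: bil_def scalar_product_def)
    then have "\<delta> *s (T *v v) = 0" for v
      unfolding expand by (simp add: bil_def)
    then have Tv: "T *v v = 0" for v using \<delta> by simp
    have "\<forall>i j. T $ i $ j = 0"
      using Tv[of "vector [1,0,0]"] Tv[of "vector [0,1,0]"] Tv[of "vector [0,0,1]"]
      by (simp add: matrix_vector_mult_def sum_3 vec_eq_iff forall_3)
    then have "adjugate ?X $ i $ j = \<alpha> * adjugate ?C $ i $ j" for i j by (simp add: T_def)
    then show False using same_conicI[OF X C \<alpha>] not_same by blast
  qed

  \<comment> \<open>The shift cancels the diag(1, 1, 0) part of the dual circle, so that
    \<open>N\<close> is \<open>T\<close> plus \<alpha> times the rank one form of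
    \<open>M\<close>.\<close>
  define N where "N = dual_shift (adjugate ?X) (\<alpha> * \<rho>)"
  have sN: "transpose N = N"
    using symmetric_entries[OF sX] by (simp add: N_def dual_shift_def transpose_def vec_eq_iff forall_3)
  have bil_N: "bil N u v = bil T u v + \<alpha> * scalar_product (hpt M) u * scalar_product (hpt M) v" for u v
    by (simp add: N_def bil_dual_shift bil_T bil_adjugate_circle algebra_simps)
  have N_vec: "\<delta> *s (N *v u) = \<delta> *s (T *v u) + (\<delta> * \<alpha> * scalar_product (hpt M) u) *s hpt M" for u
  proof -
    have e: "\<delta> *s (S *v u) = bil S f u *s P + bil S g u *s Q + bil S h u *s hpt M" for S u
      unfolding expand bil_def ..
    show ?thesis
      unfolding e bil_N using pair
      by (simp add: \<delta>_def[symmetric] scalar_product_commute[of "hpt M"] vec_eq_iff algebra_simps)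
  qed
  \<comment> \<open>\<open>N\<close> sends the sides of the triangle to multiples of the opposite or
    adjacent vertices \<open>Q\<close>, \<open>P\<close>, \<open>M\<close>. These are independent,
    so \<open>N\<close> is invertible, and they are the poles of \<open>f\<close>, \<open>g\<close>,
    \<open>h\<close>.\<close>
  have Nf: "\<delta> *s (N *v f) = \<gamma> *s Q" and Ng: "\<delta> *s (N *v g) = \<gamma> *s P"
    and Nh: "\<delta> *s (N *v h) = (\<delta> * \<alpha> * \<delta>) *s hpt M"
    unfolding N_vec T_vec using pair \<delta>_def
    by (simp_all add: scalar_product_commute[of "hpt M"])
  have inj: "v = 0" if "N *v v = 0" for v
  proof -
    have "scalar_product v (\<delta> *s (N *v u)) = 0" for u
    proof -
      have "scalar_product v (\<delta> *s (N *v u)) = \<delta> * bil N v u"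
        by (simp add: bil_def scalar_product_def sum_3 algebra_simps)
      also have "bil N v u = 0" using that bil_sym[OF sN, of v u] by (simp add: bil_def scalar_product_def)
      finally show ?thesis by simp
    qed
    from this[of f] this[of g] this[of h] have "\<gamma> * scalar_product v Q = 0" "\<gamma> * scalar_product v P = 0"
      "\<delta> * \<alpha> * \<delta> * scalar_product v (hpt M) = 0"
      unfolding Nf Ng Nh by (simp_all add: scalar_product_def sum_3 algebra_simps)
    then have "\<delta> *s v = 0"
      using \<gamma> \<delta> \<alpha> by (simp add: \<delta>_def h_def dual_triple_expansion)
    then show ?thesis using \<delta> by simp
  qed
  have N: "nondeg_conic N"
    using inj sN by (simp add: nondeg_conic_def invertible_left_inverse matrix_left_invertible_ker)
  note dN = nondeg_conicD(2)[OF N]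
  define R where "R = adjugate N"
  have R: "nondeg_conic R" unfolding R_def by (rule nondeg_conic_adjugate[OF N])
  have sR: "transpose R = R" by (rule nondeg_conicD(1)[OF R])
  have bil_adj_R: "bil (adjugate R) u v = det N * bil N u v" for u v
    unfolding R_def bil_def
    by (simp add: scalar_product_def matrix_vector_mult_def sum_3 adjugate_adjugate algebra_simps)

  have "tangent ?X l \<longleftrightarrow> tangent R l" if "incident circ_I l \<or> incident circ_J l" for l
    using isotropic_coords[OF that] dN
    by (simp add: tangent_iff[OF X] tangent_iff[OF R] bil_adj_R N_def bil_dual_shift)
  then have confocal: "confocal ?X R"
    by (auto simp: confocal_def isotropic_tangents_def)

  have distinct_conics: "\<not> same_conic R ?X"
  proof
    assume "same_conic R ?X"
    then obtain k where k: "k \<noteq> 0" "\<And>i j. R $ i $ j = k * ?X $ i $ j" unfolding same_conic_def by blast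
    have "\<forall>i j. adjugate R $ i $ j = k\<^sup>2 * adjugate ?X $ i $ j"
      unfolding adjugate_def by (simp add: forall_3 k(2) power2_eq_square algebra_simps del: cmat_nth)
    then have "det N * N $ i $ j = k\<^sup>2 * adjugate ?X $ i $ j" for i j
      by (simp add: R_def adjugate_adjugate)
    \<comment> \<open>The shift leaves the (3, 3) entry alone but adds the nonzero
      \<open>\<alpha> * \<rho>\<close> to the (1, 1) entry, so no common factor fits both.\<close>
    from this[of 3 3] this[of 1 1]
    have eqs: "det N * adjugate ?X $ 3 $ 3 = k\<^sup>2 * adjugate ?X $ 3 $ 3"
      "det N * (adjugate ?X $ 1 $ 1 + \<alpha> * \<rho>) = k\<^sup>2 * adjugate ?X $ 1 $ 1"
      by (simp_all add: N_def dual_shift_def)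
    have "adjugate ?X $ 3 $ 3 \<noteq> 0"
      using ellipse_adjugate_33[OF assms(1)] by (simp flip: cmat_adjugate)
    then have "det N = k\<^sup>2" using eqs(1) by simp
    then show False using eqs(2) dN \<alpha> \<rho> by (auto simp: algebra_simps)
  qed
  have tangent_at: "tangent_at R p l"
    if "\<delta> *s (N *v l) = \<gamma> *s p" "scalar_product l p = 0" "l \<noteq> 0" "p \<noteq> 0" for p l
  proof -
    \<comment> \<open>Being the adjugate of \<open>N\<close>, \<open>R\<close> sends the pole
      \<open>p\<close> back to its polar \<open>l\<close>.\<close>
    have "R *v (\<delta> *s (N *v l)) = (\<delta> * det N) *s l"
      by (simp add: R_def vector_scalar_commute adjugate_mult_vec)
    moreover have "R *v (\<gamma> *s p) = \<gamma> *s (R *v p)" by (simp add: vector_scalar_commute)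
    ultimately have "\<gamma> *s (R *v p) = (\<delta> * det N) *s l" using that(1) by metis
    then have "(1 / \<gamma>) *s (\<gamma> *s (R *v p)) = (1 / \<gamma>) *s ((\<delta> * det N) *s l)" by simp
    then have Rp: "R *v p = (\<delta> * det N / \<gamma>) *s l" using \<gamma> by simp
    then have l: "l = (\<gamma> / (\<delta> * det N)) *s (R *v p)" using \<gamma> \<delta> dN by simp
    have "R *v p \<noteq> 0" using l that(3) by auto
    moreover have "scalar_product p (R *v p) = (\<delta> * det N / \<gamma>) * scalar_product l p"
      unfolding Rp by (simp add: scalar_product_def sum_3 algebra_simps)
    ultimately show ?thesis
      using l that unfolding tangent_at_def on_conic_def proj_eq_def by auto
  qed
  have "scalar_product 0 u = 0" for u :: "complex^3" by (simp add: scalar_product_def)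
  then have fg: "f \<noteq> 0" "g \<noteq> 0" using pair \<delta> by metis+
  have "tangent_at R P (join (hpt M) P)"
    using tangent_at[OF Ng pair(4) fg(2) P0] unfolding g_def .
  moreover have "tangent_at R Q f"
    by (rule tangent_at[OF Nf pair(2) fg(1) Q0])
  then have "tangent_at R Q (join (hpt M) Q)"
  proof -
    have e: "cross (hpt M) Q = (- 1) *s f" by (simp add: f_def coords)
    have "cross (hpt M) Q \<noteq> 0" using e fg by simp
    then have "proj_eq (cross (hpt M) Q) f" using e fg unfolding proj_eq_def by blast
    then show ?thesis using \<open>tangent_at R Q f\<close> proj_eq_trans
      unfolding tangent_at_def by (metis proj_eq_def)
  qed
  moreover have "\<exists>S :: real^3^3. R = cmat S" if "real_point P" "real_point Q"
  proof -
    obtain j v k w where PQ: "P = j *s cvec v" "Q = k *s cvec w"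
      using \<open>real_point P\<close> \<open>real_point Q\<close> unfolding real_point_def proj_eq_def by blast
    \<comment> \<open>A real multiple representative of the line \<open>h\<close>. At
      \<open>r\<close> the two dual forms take real nonzero values with quotient \<alpha>, so
      \<alpha> and hence \<open>R\<close> are real.\<close>
    define r where "r = cross (cvec v) (cvec w)"
    have hr: "h = (j * k) *s r" by (simp add: h_def PQ r_def cross_scale)
    have "incident P r" by (simp add: PQ r_def incident_def) (simp add: coords cvec_def algebra_simps)
    note on_P[OF this]
    moreover have "bil (adjugate ?X) r r \<noteq> 0" using Xh by (auto simp: hr bil_scale)
    moreover have "Im (bil (cmat S) r r) = 0" for S by (simp add: r_def coords cvec_def)
    then have "Im (bil (adjugate ?X) r r) = 0" "Im (bil (adjugate ?C) r r) = 0"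
      by (simp_all flip: cmat_adjugate)
    ultimately obtain x where "\<alpha> = complex_of_real x" using real_ratio by fastforce
    then have "R = cmat (adjugate (dual_shift (adjugate X) (x * \<rho>)))"
      by (simp add: R_def N_def cmat_adjugate cmat_dual_shift)
    then show ?thesis by blast
  qed
  ultimately show ?thesis using R confocal distinct_conics by blast
qed

theorem theorem2:
  fixes X :: "real^3^3"
  assumes "ellipse X"
  shows "(\<forall>(R :: real^3^3) (P :: real^2) (Q :: real^2) tP tQ a b c d.
            nondeg_conic (cmat R) \<and> confocal (cmat X) (cmat R) \<and> \<not> same_conic (cmat R) (cmat X) \<and>
            P \<noteq> Q \<and> tangent_at (cmat R) (hpt P) tP \<and> tangent_at (cmat R) (hpt Q) tQ \<and>
            tangents_from (cmat X) (hpt P) a b \<and> tangents_from (cmat X) (hpt Q) c d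
            \<longrightarrow> meet tP tQ \<noteq> 0 \<and>
                (\<forall>M :: real^2. proj_eq (hpt M) (meet tP tQ) \<longrightarrow>
                   (\<exists>\<rho>. \<rho> \<noteq> 0 \<and>
                        ((\<exists>z. on_conic (cmat R) (hpt z) \<and> \<not> lies_inside X z) \<longrightarrow> \<rho> > 0) \<and>
                        touches_both (cmat (circle M \<rho>)) (hpt P) a b \<and>
                        touches_both (cmat (circle M \<rho>)) (hpt Q) c d)))
       \<and> (\<forall>(M :: real^2) (\<rho> :: real) a b c d P Q.
            \<rho> \<noteq> 0 \<and> \<not> same_conic (cmat X) (cmat (circle M \<rho>)) \<and>
            (\<forall>l\<in>{a, b, c, d}. tangent (cmat X) l \<and> tangent (cmat (circle M \<rho>)) l) \<and>
            \<not> proj_eq a c \<and> \<not> proj_eq a d \<and> \<not> proj_eq b c \<and> \<not> proj_eq b d \<and>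
            tangents_meet (cmat X) (cmat (circle M \<rho>)) a b P \<and>
            tangents_meet (cmat X) (cmat (circle M \<rho>)) c d Q \<and>
            \<not> incident (hpt M) (join P Q)
            \<longrightarrow> (\<exists>R :: complex^3^3.
                   nondeg_conic R \<and> confocal (cmat X) R \<and> \<not> same_conic R (cmat X) \<and>
                   tangent_at R P (join (hpt M) P) \<and> tangent_at R Q (join (hpt M) Q) \<and>
                   (real_point P \<and> real_point Q \<longrightarrow> (\<exists>S :: real^3^3. R = cmat S))))"
  using confocal_tangents_touch_circle[OF assms] common_tangents_confocal_conic[OF assms]
  by (intro conjI allI impI; elim conjE) blast+

end
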